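(* Let $R\in C^1([0,T]\to\mathrm{SO}(3))$, $t\mapsto R_t$, be continuously differentiable and let $t\in[0,T]$. Let $\boldsymbol\phi=(\phi_1,\phi_2)^\top\in\mathbb{S}^1_+$ be a unique direction in $\mathbb{S}^1_+$ with the property that there exist parameters $\rho,\zeta\in\mathbb{R}$ with $$\partial_t\tilde\nu_t(r\boldsymbol\phi)=(k_0\rho+r\zeta)\left\langle\nabla\tilde\nu_t(r\boldsymbol\phi),\begin{pmatrix}-\phi_2\\\phi_1\end{pmatrix}\right\rangle\quad\text{for all }r\in\mathbb{R}\setminus[-k_0,k_0].$$ Provided that the set $$\mathcal M_t=\left\{r\in\mathbb{R}\setminus[-k_0,k_0]:\left\langle\nabla\tilde\nu_t(r\boldsymbol\phi),\begin{pmatrix}-\phi_2\\\phi_1\end{pmatrix}\right\rangle\neq0\right\}$$ contains at least two elements, the angular velocity of $R$ at time $t$ is given by $\boldsymbol\omega_t=(\rho\phi_1,\rho\phi_2,\zeta)^\top$.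
   Context: Fix $k_0>0$, $T>0$. $f\colon\mathbb{R}^3\to[0,\infty)$ is a piecewise continuous function supported in an open ball around $\boldsymbol 0$; $\mathcal{F}[f](\boldsymbol y)=(2\pi)^{-3/2}\int_{\mathbb{R}^3}f(\boldsymbol x)\,e^{-i\langle\boldsymbol x,\boldsymbol y\rangle}\,d\boldsymbol x$. The rotations satisfy $R_0=I$. For $\boldsymbol k\in\mathcal{B}^2_{k_0}=\{\boldsymbol k\in\mathbb{R}^2:\|\boldsymbol k\|<k_0\}$ let $\kappa(\boldsymbol k)=\sqrt{k_0^2-\|\boldsymbol k\|^2}$, $\boldsymbol h(\boldsymbol k)=(k_1,k_2,\kappa(\boldsymbol k)-k_0)^\top$ and $\nu_t(\boldsymbol k)=|\mathcal{F}[f](R_t\boldsymbol h(\boldsymbol k))|^2$. The map $\tau\colon\mathcal{B}^2_{k_0}\setminus\{\boldsymbol 0\}\to\mathbb{R}^2\setminus\overline{\mathcal{B}^2_{k_0}}$, $\tau(\boldsymbol k)=\frac{k_0}{k_0-\kappa(\boldsymbol k)}\boldsymbol k$, is a bijection with inverse $\tau^{-1}(\boldsymbol y)=\frac{2k_0^2}{k_0^2+\|\boldsymbol y\|^2}\boldsymbol y$, and $\tilde\nu_t=\nu_t\circ\tau^{-1}\colon\mathbb{R}^2\setminus\overline{\mathcal{B}^2_{k_0}}\to[0,\infty)$. $\partial_t\tilde\nu_t$ is the partial derivative in $t$ (one-sided at the endpoints), $\nabla\tilde\nu_t$ the gradient in the spatial variable. $\mathbb{S}^1_+=\{(\cos\alpha,\sin\alpha)^\top:\alpha\in[0,\pi)\}$.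 The angular velocity $\boldsymbol\omega_t\in\mathbb{R}^3$ is defined by $R_t^\top R_t'\boldsymbol y=\boldsymbol\omega_t\times\boldsymbol y$ for all $\boldsymbol y\in\mathbb{R}^3$, where $R_t'$ is the time derivative. *)

theory Defs
  imports "HOL-Analysis.Analysis"
begin

section \<open>The object and its Fourier transform\<close>

text \<open>
  Piecewise continuity: up to a null set, space is divided into finitely many disjoint open
  pieces, and on each piece the function extends continuously to the closed piece.
  The values on the interfaces between the pieces are unrestricted.
\<close>

definition piecewise_continuous :: "(real^3 \<Rightarrow> real) \<Rightarrow> bool" where
  "piecewise_continuous f \<longleftrightarrow>
     (\<exists>\<P>. finite \<P> \<and> disjoint \<P> \<and> (\<forall>U\<in>\<P>. open U) \<and> negligible (- \<Union>\<P>) \<and>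
          (\<forall>U\<in>\<P>. \<exists>g. continuous_on (closure U) g \<and> (\<forall>x\<in>U. f x = g x)))"

text \<open>
  The integral is taken with respect to the completed Lebesgue measure, since a piecewise
  continuous function need not be Borel measurable on the interfaces.
\<close>

definition fourier3 :: "(real^3 \<Rightarrow> real) \<Rightarrow> real^3 \<Rightarrow> complex" where
  "fourier3 f y =
     complex_of_real ((2 * pi) powr (-3/2)) *
     (LINT x|lebesgue. complex_of_real (f x) * exp (- (\<i> * complex_of_real (x \<bullet> y))))"

section \<open>Scaled squared energy\<close>

definition kappa :: "real \<Rightarrow> real^2 \<Rightarrow> real" where
  "kappa k0 k = sqrt (k0\<^sup>2 - (norm k)\<^sup>2)"

definition hemisphere :: "real \<Rightarrow> real^2 \<Rightarrow> real^3" where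
  "hemisphere k0 k = vector [k$1, k$2, kappa k0 k - k0]"

definition nu :: "real \<Rightarrow> (real^3 \<Rightarrow> real) \<Rightarrow> (real \<Rightarrow> real^3^3) \<Rightarrow> real \<Rightarrow> real^2 \<Rightarrow> real" where
  "nu k0 f R t k = (cmod (fourier3 f (R t *v hemisphere k0 k)))\<^sup>2"

definition tau :: "real \<Rightarrow> real^2 \<Rightarrow> real^2" where
  "tau k0 k = (k0 / (k0 - kappa k0 k)) *\<^sub>R k"

definition tau_inv :: "real \<Rightarrow> real^2 \<Rightarrow> real^2" where
  "tau_inv k0 = inv_into (ball 0 k0 - {0}) (tau k0)"

text \<open>Only the values for \<^term>\<open>y \<in> - cball 0 k0\<close> are meaningful.\<close>

definition nu_tilde :: "real \<Rightarrow> (real^3 \<Rightarrow> real) \<Rightarrow> (real \<Rightarrow> real^3^3) \<Rightarrow> real \<Rightarrow> real^2 \<Rightarrow> real" where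
  "nu_tilde k0 f R t y = nu k0 f R t (tau_inv k0 y)"

definition gradient :: "('a::real_inner \<Rightarrow> real) \<Rightarrow> 'a \<Rightarrow> 'a" where
  "gradient g x = (THE D. GDERIV g x :> D)"

section \<open>Rotations\<close>

text \<open>Derivatives are relative to \<^term>\<open>{0..T}\<close>, hence one-sided at the endpoints.\<close>

definition C1_rotations :: "real \<Rightarrow> (real \<Rightarrow> real^3^3) \<Rightarrow> bool" where
  "C1_rotations T R \<longleftrightarrow>
     (\<forall>s\<in>{0..T}. rotation_matrix (R s)) \<and>
     (\<exists>R'. (\<forall>s\<in>{0..T}. (R has_vector_derivative R' s) (at s within {0..T})) \<and>
           continuous_on {0..T} R')"

definition angular_velocity :: "real \<Rightarrow> (real \<Rightarrow> real^3^3) \<Rightarrow> real \<Rightarrow> real^3" where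
  "angular_velocity T R t =
     (THE \<omega>. \<forall>y. (transpose (R t) ** vector_derivative R (at t within {0..T})) *v y = cross3 \<omega> y)"

section \<open>Directions\<close>

definition half_circle :: "(real^2) set" where
  "half_circle = {vector [cos \<alpha>, sin \<alpha>] |\<alpha>. 0 \<le> \<alpha> \<and> \<alpha> < pi}"

definition perp :: "real^2 \<Rightarrow> real^2" where
  "perp \<phi> = vector [- \<phi>$2, \<phi>$1]"

definition infinitesimal_relation ::
  "real \<Rightarrow> real \<Rightarrow> (real^3 \<Rightarrow> real) \<Rightarrow> (real \<Rightarrow> real^3^3) \<Rightarrow> real \<Rightarrow> real^2 \<Rightarrow> real \<Rightarrow> real \<Rightarrow> bool" where
  "infinitesimal_relation k0 T f R t \<phi> \<rho> \<zeta> \<longleftrightarrow>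
     (\<forall>r\<in>- {-k0..k0}.
        vector_derivative (\<lambda>s. nu_tilde k0 f R s (r *\<^sub>R \<phi>)) (at t within {0..T}) =
        (k0 * \<rho> + r * \<zeta>) * (gradient (nu_tilde k0 f R t) (r *\<^sub>R \<phi>) \<bullet> perp \<phi>))"

section \<open>The inverse of \<open>\<tau>\<close> and well-definedness of the definite descriptions\<close>

lemma tau_inv_formula_mem:
  assumes "k0 > 0" "norm y > k0"
  defines "k \<equiv> (2 * k0\<^sup>2 / (k0\<^sup>2 + (norm y)\<^sup>2)) *\<^sub>R y"
  shows "k \<in> ball 0 k0 - {0}" "tau k0 k = y"
proof -
  define n where "n = norm y"
  have n: "n > k0" "n > 0" using assms by (auto simp: n_def)
  have p: "k0\<^sup>2 + n\<^sup>2 > 0" using assms by (simp add: add_pos_nonneg)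
  have nk: "norm k = 2 * k0\<^sup>2 * n / (k0\<^sup>2 + n\<^sup>2)"
    using p by (simp add: k_def n_def)
  have "(n - k0)\<^sup>2 > 0" using n by simp
  then have "2 * k0 * n < k0\<^sup>2 + n\<^sup>2" by (simp add: power2_diff algebra_simps)
  then have "k0 * (2 * k0 * n) < k0 * (k0\<^sup>2 + n\<^sup>2)" using assms(1) by (rule mult_strict_left_mono)
  then have "norm k < k0" using p unfolding nk by (simp add: divide_less_eq power2_eq_square mult_ac)
  moreover have "k \<noteq> 0" using p n assms(1) by (auto simp: k_def n_def)
  ultimately show "k \<in> ball 0 k0 - {0}" by simp
  have "k0\<^sup>2 - (norm k)\<^sup>2 = (k0 * (n\<^sup>2 - k0\<^sup>2) / (k0\<^sup>2 + n\<^sup>2))\<^sup>2"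
  proof -
    define N where "N = k0\<^sup>2 + n\<^sup>2"
    have "k0\<^sup>2 - (2 * k0\<^sup>2 * n / N)\<^sup>2 = (k0\<^sup>2 * N\<^sup>2 - (2 * k0\<^sup>2 * n)\<^sup>2) / N\<^sup>2"
      using p by (simp add: N_def power_divide diff_divide_distrib)
    also have "k0\<^sup>2 * N\<^sup>2 - (2 * k0\<^sup>2 * n)\<^sup>2 = (k0 * (n\<^sup>2 - k0\<^sup>2))\<^sup>2"
      unfolding N_def by algebra
    finally show ?thesis by (simp add: nk N_def power_divide)
  qed
  moreover have "k0\<^sup>2 \<le> n\<^sup>2" using n assms(1) by (intro power_mono) auto
  ultimately have kap: "kappa k0 k = k0 * (n\<^sup>2 - k0\<^sup>2) / (k0\<^sup>2 + n\<^sup>2)"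
    using p assms(1) by (simp add: kappa_def)
  have "k0 * (k0\<^sup>2 + n\<^sup>2) - k0 * (n\<^sup>2 - k0\<^sup>2) = 2 * k0^3" by algebra
  then have "(k0 * (k0\<^sup>2 + n\<^sup>2) - k0 * (n\<^sup>2 - k0\<^sup>2)) / (k0\<^sup>2 + n\<^sup>2) = 2 * k0^3 / (k0\<^sup>2 + n\<^sup>2)"
    by (rule arg_cong)
  then have "k0 - kappa k0 k = 2 * k0^3 / (k0\<^sup>2 + n\<^sup>2)"
    unfolding kap using p assms(1) by (simp add: diff_divide_distrib)
  then have "k0 / (k0 - kappa k0 k) * (2 * k0\<^sup>2 / (k0\<^sup>2 + n\<^sup>2)) = 1"
    using p assms(1) by (simp add: power2_eq_square power3_eq_cube)
  then show "tau k0 k = y"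
    unfolding tau_def by (metis k_def n_def scaleR_one scaleR_scaleR)
qed

lemma tau_exterior:
  assumes "k0 > 0" "k \<in> ball 0 k0 - {0}"
  shows "norm (tau k0 k) > k0"
    "(2 * k0\<^sup>2 / (k0\<^sup>2 + (norm (tau k0 k))\<^sup>2)) *\<^sub>R tau k0 k = k"
proof -
  define a where "a = kappa k0 k"
  have s: "0 < norm k" "norm k < k0" using assms by auto
  then have s2: "(norm k)\<^sup>2 < k0\<^sup>2" by (intro power_strict_mono) auto
  have a2: "a\<^sup>2 = k0\<^sup>2 - (norm k)\<^sup>2" and a: "0 < a" using s2 by (auto simp: a_def kappa_def)
  have "a\<^sup>2 < k0\<^sup>2" using a2 s by simp
  then have ak: "a < k0" using assms(1) by (simp add: power2_less_imp_less)
  have nk: "(norm k)\<^sup>2 = (k0 - a) * (k0 + a)" using a2 by (simp add: power2_eq_square algebra_simps)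
  have nt: "norm (tau k0 k) = k0 / (k0 - a) * norm k"
    using ak assms(1) by (simp add: tau_def a_def)
  have "(k0 - a) * (k0 - a) < (k0 - a) * (k0 + a)" using a ak by (intro mult_strict_left_mono) auto
  then have "(k0 - a)\<^sup>2 < (norm k)\<^sup>2" by (simp only: nk power2_eq_square[of "k0 - a"])
  then have "k0 - a < norm k" by (rule power2_less_imp_less) simp
  then show "norm (tau k0 k) > k0" unfolding nt using ak assms(1) by (simp add: less_divide_eq)
  define d where "d = k0 - a"
  have d: "d > 0" using ak by (simp add: d_def)
  have "(norm (tau k0 k))\<^sup>2 = k0\<^sup>2 * (k0 + a) / d"
    unfolding nt power_mult_distrib nk d_def[symmetric] using d by (simp add: power2_eq_square)
  moreover have "k0\<^sup>2 * d + k0\<^sup>2 * (k0 + a) = 2 * k0^3" unfolding d_def by algebra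
  ultimately have "k0\<^sup>2 + (norm (tau k0 k))\<^sup>2 = 2 * k0^3 / d"
    using d by (simp add: field_simps)
  then have "2 * k0\<^sup>2 / (k0\<^sup>2 + (norm (tau k0 k))\<^sup>2) * (k0 / (k0 - a)) = 1"
    unfolding d_def[symmetric] using d assms(1) by (simp add: power2_eq_square power3_eq_cube)
  then show "(2 * k0\<^sup>2 / (k0\<^sup>2 + (norm (tau k0 k))\<^sup>2)) *\<^sub>R tau k0 k = k"
    by (metis a_def scaleR_one scaleR_scaleR tau_def)
qed

lemma bij_betw_tau:
  assumes "k0 > 0"
  shows "bij_betw (tau k0) (ball 0 k0 - {0}) (- cball 0 k0)"
proof (rule bij_betw_byWitness[where f' = "\<lambda>y. (2 * k0\<^sup>2 / (k0\<^sup>2 + (norm y)\<^sup>2)) *\<^sub>R y"])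
  show "\<forall>k\<in>ball 0 k0 - {0}. (2 * k0\<^sup>2 / (k0\<^sup>2 + (norm (tau k0 k))\<^sup>2)) *\<^sub>R tau k0 k = k"
    using tau_exterior(2)[OF assms] by blast
  show "\<forall>y\<in>- cball 0 k0. tau k0 ((2 * k0\<^sup>2 / (k0\<^sup>2 + (norm y)\<^sup>2)) *\<^sub>R y) = y"
    using tau_inv_formula_mem(2)[OF assms] by (simp add: not_le)
  show "tau k0 ` (ball 0 k0 - {0}) \<subseteq> - cball 0 k0"
    using tau_exterior(1)[OF assms] by (simp add: image_subset_iff not_le)
  show "(\<lambda>y::real^2. (2 * k0\<^sup>2 / (k0\<^sup>2 + (norm y)\<^sup>2)) *\<^sub>R y) ` (- cball 0 k0) \<subseteq> ball 0 k0 - {0}"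
  proof (rule image_subsetI)
    fix y :: "real^2" assume "y \<in> - cball 0 k0"
    then have "norm y > k0" by (simp add: not_le)
    then show "(2 * k0\<^sup>2 / (k0\<^sup>2 + (norm y)\<^sup>2)) *\<^sub>R y \<in> ball 0 k0 - {0}"
      by (rule tau_inv_formula_mem(1)[OF assms])
  qed
qed

lemma tau_inv_eq:
  assumes "k0 > 0" "y \<in> - cball 0 k0"
  shows "tau_inv k0 y = (2 * k0\<^sup>2 / (k0\<^sup>2 + (norm y)\<^sup>2)) *\<^sub>R y"
proof -
  have y: "norm y > k0" using assms(2) by (simp add: not_le)
  show ?thesis
    unfolding tau_inv_def
    using bij_betw_imp_inj_on[OF bij_betw_tau[OF assms(1)]] tau_inv_formula_mem[OF assms(1) y]
    by (rule inv_into_f_eq)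
qed

lemma gradient_eq:
  assumes "GDERIV g x :> D"
  shows "gradient g x = D"
  unfolding gradient_def
proof (rule the_equality, rule assms)
  fix D' assume "GDERIV g x :> D'"
  with assms have "(\<lambda>h. h \<bullet> D') = (\<lambda>h. h \<bullet> D)"
    unfolding gderiv_def using has_derivative_unique by blast
  then have "(D' - D) \<bullet> D' = (D' - D) \<bullet> D" by metis
  then show "D' = D"
    by (metis eq_iff_diff_eq_0 inner_diff_right inner_eq_zero_iff)
qed

lemma angular_velocity:
  assumes T: "T > 0" and C1: "C1_rotations T R" and t: "t \<in> {0..T}"
  shows "(transpose (R t) ** vector_derivative R (at t within {0..T})) *v y =
         cross3 (angular_velocity T R t) y"
proof -
  define D where "D = vector_derivative R (at t within {0..T})"
  define A where "A = transpose (R t) ** D"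
  obtain R' where R': "(R has_vector_derivative R' t) (at t within {0..T})"
    using C1 t unfolding C1_rotations_def by blast
  have "at t within {0..T} \<noteq> bot" using T t by (simp add: trivial_limit_within islimpt_Icc)
  then have "D = R' t" unfolding D_def using R' by (intro vector_derivative_within)
  then have D: "(R has_vector_derivative D) (at t within {0..T})" using R' by simp
  have ent: "((\<lambda>s. R s $ i $ j) has_real_derivative D $ i $ j) (at t within {0..T})" for i j
    using bounded_linear.has_vector_derivative[OF bounded_linear_vec_nth,
        OF bounded_linear.has_vector_derivative[OF bounded_linear_vec_nth, OF D]]
    by (simp add: has_real_derivative_iff_has_vector_derivative)
  have skew: "A $ i $ j = - A $ j $ i" for i j
  proof -
    have "((\<lambda>s. \<Sum>m\<in>UNIV. R s $ m $ i * R s $ m $ j) has_real_derivative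
        (\<Sum>m\<in>UNIV. D $ m $ i * R t $ m $ j + D $ m $ j * R t $ m $ i)) (at t within {0..T})"
      by (intro DERIV_sum DERIV_mult ent)
    moreover have "((\<lambda>s. \<Sum>m\<in>UNIV. R s $ m $ i * R s $ m $ j) has_real_derivative 0)
        (at t within {0..T})"
    proof (rule has_field_derivative_transform_within[OF DERIV_const zero_less_one t])
      fix s assume "s \<in> {0..T}"
      then have "transpose (R s) ** R s = mat 1"
        using C1 by (auto simp: C1_rotations_def rotation_matrix_def orthogonal_matrix)
      then have "(transpose (R s) ** R s) $ i $ j = mat 1 $ i $ j" by simp
      then show "mat 1 $ i $ j = (\<Sum>m\<in>UNIV. R s $ m $ i * R s $ m $ j)"
        by (simp add: matrix_matrix_mult_def transpose_def)
    qed
    ultimately have "(\<Sum>m\<in>UNIV. D $ m $ i * R t $ m $ j + D $ m $ j * R t $ m $ i) = 0"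
      unfolding has_real_derivative_iff_has_vector_derivative
      by (rule vector_derivative_unique_within[OF \<open>at t within {0..T} \<noteq> bot\<close>])
    then show ?thesis
      by (simp add: A_def matrix_matrix_mult_def transpose_def sum.distrib mult.commute add_eq_0_iff)
  qed
  have diag: "A $ i $ i = 0" for i using skew[of i i] by simp
  define w :: "real^3" where "w = vector [A $ 3 $ 2, A $ 1 $ 3, A $ 2 $ 1]"
  have w: "\<forall>y. A *v y = cross3 w y"
    using skew[of 1 2] skew[of 2 3] skew[of 3 1] diag
    by (simp add: w_def cross3_def vec_eq_iff forall_3 matrix_vector_mult_def sum_3)
  have "angular_velocity T R t = w"
    unfolding angular_velocity_def D_def[symmetric] A_def[symmetric]
  proof (rule the_equality, rule w)
    fix w' assume "\<forall>y. A *v y = cross3 w' y"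
    then have eq: "cross3 w' y = cross3 w y" for y using w by metis
    show "w' = w"
      using eq[of "axis 1 1"] eq[of "axis 2 1"]
      by (simp add: cross3_def vec_eq_iff forall_3 axis_def)
  qed
  then show ?thesis using w by (simp add: A_def D_def)
qed

end

theory Submission
  imports Defs
begin

text \<open>
  Inverting the map \<open>\<tau>\<close> turns the hemisphere parametrisation into
  \<open>H y = 2 k\<^sub>0\<^sup>2 / (k\<^sub>0\<^sup>2 + |y|\<^sup>2) (y\<^sub>1, y\<^sub>2, - k\<^sub>0)\<close>, so that the rescaled energy is
  \<open>g (R\<^sub>t (H y))\<close> with \<open>g\<close> the squared modulus of the Fourier transform. Since \<open>f\<close> is
  integrable with bounded support, \<open>g\<close> is differentiable and the chain rule applies:
  in time, \<open>R\<^sub>t (H y)\<close> moves with velocity \<open>R\<^sub>t (\<omega> \<times> H y)\<close>; in space, along a direction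
  orthogonal to \<open>y\<close>, the scalar factor of \<open>H\<close> is stationary, and only the first two
  components of \<open>(y\<^sub>1, y\<^sub>2, - k\<^sub>0)\<close> vary.

  If the horizontal part of \<open>\<omega>\<close> is a multiple \<open>a \<phi>\<close> of a unit vector \<open>\<phi>\<close>, then for
  \<open>y = r \<phi>\<close> the vector \<open>\<omega> \<times> (y\<^sub>1, y\<^sub>2, - k\<^sub>0)\<close> is horizontal, orthogonal to \<open>\<phi>\<close> and of
  signed length \<open>k\<^sub>0 a + r \<omega>\<^sub>3\<close>. The two velocities are therefore proportional, and the
  infinitesimal relation holds along \<open>\<phi>\<close> with parameters \<open>a\<close> and \<open>\<omega>\<^sub>3\<close>
  (\<open>relation_of_parallel_velocity\<close>).

  Every horizontal vector is a multiple of some direction in the half circle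
  (\<open>half_circle_direction\<close>), so uniqueness forces that direction to be the given one.
  The relation then holds there both with \<open>(\<rho>, \<zeta>)\<close> and with \<open>(a, \<omega>\<^sub>3)\<close>; at the two
  radii where the transversal derivative does not vanish it can be cancelled, and the affine
  functions \<open>k\<^sub>0 \<rho> + r \<zeta>\<close> and \<open>k\<^sub>0 a + r \<omega>\<^sub>3\<close> of \<open>r\<close>, agreeing at two points, coincide.
\<close>

section \<open>Differentiability of the squared Fourier modulus\<close>

text \<open>
  On each piece, \<open>f\<close> agrees with a function continuous on a compact set, namely the closed
  piece cut off at radius \<open>r\<close>; the arbitrary values on the interfaces live on a
  null set, which the completed measure disregards.
\<close>

lemma piecewise_continuous_imp_integrable:
  assumes pc: "piecewise_continuous f" and supp: "\<And>x. r \<le> norm x \<Longrightarrow> f x = 0"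
  shows "integrable lebesgue f"
proof -
  obtain \<P> where fin: "finite \<P>" and op: "\<And>U. U \<in> \<P> \<Longrightarrow> open U"
    and neg: "negligible (- \<Union>\<P>)"
    and ext: "\<And>U. U \<in> \<P> \<Longrightarrow> \<exists>g. continuous_on (closure U) g \<and> (\<forall>x\<in>U. f x = g x)"
    using pc unfolding piecewise_continuous_def by blast
  have piece: "set_integrable lebesgue (U \<inter> ball 0 r) f" if U: "U \<in> \<P>" for U
  proof -
    obtain g where g: "continuous_on (closure U) g" "\<And>x. x \<in> U \<Longrightarrow> f x = g x"
      using ext[OF U] by blast
    let ?K = "closure U \<inter> cball 0 r"
    have "compact ?K" by (intro closed_Int_compact) auto
    moreover have "continuous_on ?K g" by (rule continuous_on_subset[OF g(1)]) auto
    ultimately have "integrable lborel (\<lambda>x. indicator ?K x *\<^sub>R g x)"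
      by (rule borel_integrable_compact)
    then have "set_integrable lebesgue ?K g"
      unfolding set_integrable_def
      using integrable_completion borel_measurable_integrable by blast
    then have "set_integrable lebesgue (U \<inter> ball 0 r) g"
      using op[OF U] closure_subset by (rule_tac set_integrable_subset) auto
    then show ?thesis
      unfolding set_integrable_def
      by (rule Bochner_Integration.integrable_cong[THEN iffD1, rotated 2])
        (auto simp: indicator_def g(2))
  qed
  have "set_integrable lebesgue (\<Union>U\<in>\<P>. U \<inter> ball 0 r) f"
    using fin piece op by (intro set_integrable_UN) auto
  then have "(\<lambda>x. indicator (\<Union>U\<in>\<P>. U \<inter> ball 0 r) x *\<^sub>R f x) absolutely_integrable_on UNIV"
    by (simp add: set_integrable_def)
  then have "f absolutely_integrable_on UNIV"
  proof (rule absolutely_integrable_spike[OF _ neg])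
    fix x assume "x \<in> UNIV - - \<Union>\<P>"
    then show "f x = indicator (\<Union>U\<in>\<P>. U \<inter> ball 0 r) x *\<^sub>R f x"
      using supp[of x] by (auto simp: indicator_def not_less)
  qed
  then show ?thesis by (simp add: set_integrable_def)
qed

text \<open>
  Differentiation under the integral sign: the second-order Taylor bound for
  \<open>exp\<close> on the imaginary axis is uniform over the bounded support, so the remainder is
  at most a constant times \<open>|h|\<^sup>2\<close>.
\<close>

lemma fourier_integral_differentiable:
  fixes f :: "'a::euclidean_space \<Rightarrow> real"
  assumes int: "integrable lebesgue f" and supp: "\<And>x. r \<le> norm x \<Longrightarrow> f x = 0"
  shows "(\<lambda>y. LINT x|lebesgue. complex_of_real (f x) * exp (- (\<i> * complex_of_real (x \<bullet> y))))
           differentiable (at y)"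
proof -
  define e where "e x y = exp (- (\<i> * complex_of_real (x \<bullet> y)))" for x y :: 'a
  define d where "d h x = - (\<i> * complex_of_real (x \<bullet> h)) * e x y" for h x
  have ne: "norm (e x z) = 1" for x z by (simp add: e_def)
  have [measurable]: "(\<lambda>x. e x z) \<in> borel_measurable lebesgue" for z
    unfolding e_def
    by (intro measurable_completion) (auto intro!: borel_measurable_continuous_onI continuous_intros)
  have [measurable]: "d h \<in> borel_measurable lebesgue" for h
    unfolding d_def e_def
    by (intro measurable_completion) (auto intro!: borel_measurable_continuous_onI continuous_intros)
  have [measurable]: "f \<in> borel_measurable lebesgue" using int by simp
  have xh: "\<bar>f x\<bar> * \<bar>x \<bullet> h\<bar> ^ n \<le> \<bar>f x\<bar> * (\<bar>r\<bar> * norm h) ^ n" for x h n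
  proof (cases "f x = 0")
    case False
    then have "norm x \<le> \<bar>r\<bar>" using supp[of x] by linarith
    then have "\<bar>x \<bullet> h\<bar> \<le> \<bar>r\<bar> * norm h"
      using Cauchy_Schwarz_ineq2[of x h] by (meson mult_right_mono norm_ge_zero order_trans)
    then show ?thesis by (intro mult_left_mono power_mono) auto
  qed simp
  have int0: "integrable lebesgue (\<lambda>x. complex_of_real (f x) * e x z)" for z
    by (rule Bochner_Integration.integrable_bound[OF int]) (auto simp: norm_mult ne)
  have int1: "integrable lebesgue (\<lambda>x. complex_of_real (f x) * d h x)" for h
  proof (rule Bochner_Integration.integrable_bound)
    show "integrable lebesgue (\<lambda>x. \<bar>f x\<bar> * (\<bar>r\<bar> * norm h) ^ 1)" using int by simp
    show "AE x in lebesgue. norm (complex_of_real (f x) * d h x) \<le> norm (\<bar>f x\<bar> * (\<bar>r\<bar> * norm h) ^ 1)"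
      using xh[of _ h 1] by (auto simp: norm_mult d_def ne)
  qed simp
  define F where "F z = (LINT x|lebesgue. complex_of_real (f x) * e x z)" for z
  define L where "L h = (LINT x|lebesgue. complex_of_real (f x) * d h x)" for h
  have "linear L"
  proof (rule linearI)
    fix a b
    have "L (a + b) = (LINT x|lebesgue. complex_of_real (f x) * d a x + complex_of_real (f x) * d b x)"
      unfolding L_def by (intro Bochner_Integration.integral_cong) (auto simp: d_def algebra_simps inner_add_right)
    then show "L (a + b) = L a + L b" unfolding L_def by (simp add: int1)
  next
    fix c :: real and a
    have "L (c *\<^sub>R a) = (LINT x|lebesgue. c *\<^sub>R (complex_of_real (f x) * d a x))"
      unfolding L_def by (intro Bochner_Integration.integral_cong) (auto simp: d_def scaleR_conv_of_real algebra_simps)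
    then show "L (c *\<^sub>R a) = c *\<^sub>R L a" unfolding L_def by simp
  qed
  then have bl: "bounded_linear L" by (simp add: linear_conv_bounded_linear)
  define C where "C = (LINT x|lebesgue. \<bar>f x\<bar>) * r\<^sup>2"
  have rem: "norm (F z - F y - L (z - y)) \<le> C * (norm (z - y))\<^sup>2" for z
  proof -
    let ?h = "z - y"
    let ?q = "\<lambda>x. complex_of_real (f x) * e x z - complex_of_real (f x) * e x y
                  - complex_of_real (f x) * d ?h x"
    have "norm (?q x) \<le> \<bar>f x\<bar> * (\<bar>r\<bar> * norm ?h)\<^sup>2" for x
    proof -
      define w where "w = - (\<i> * complex_of_real (x \<bullet> ?h))"
      have "e x z = e x y * exp w"
        unfolding e_def w_def by (simp add: exp_add[symmetric] algebra_simps inner_diff_right)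
      then have "?q x = complex_of_real (f x) * e x y * (exp w - (\<Sum>k\<le>1. w ^ k / fact k))"
        by (simp add: d_def w_def algebra_simps)
      then have "norm (?q x) = \<bar>f x\<bar> * norm (exp w - (\<Sum>k\<le>1. w ^ k / fact k))"
        by (simp only: norm_mult ne norm_of_real mult_1_right)
      also have "\<dots> \<le> \<bar>f x\<bar> * \<bar>x \<bullet> ?h\<bar> ^ 2"
        using Taylor_exp[of w 1] by (intro mult_left_mono) (auto simp: w_def norm_mult power2_eq_square)
      also have "\<dots> \<le> \<bar>f x\<bar> * (\<bar>r\<bar> * norm ?h)\<^sup>2" by (rule xh)
      finally show ?thesis .
    qed
    then have "norm (LINT x|lebesgue. ?q x) \<le> (LINT x|lebesgue. \<bar>f x\<bar> * (\<bar>r\<bar> * norm ?h)\<^sup>2)"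
      using int by (intro order.trans[OF integral_norm_bound integral_mono]) (auto simp: int0 int1)
    moreover have "(LINT x|lebesgue. ?q x) = F z - F y - L ?h"
      unfolding F_def L_def by (simp add: int0 int1)
    ultimately show ?thesis by (simp add: C_def power_mult_distrib mult_ac)
  qed
  have "(F has_derivative L) (at y)"
  proof (rule has_derivativeI_sandwich[OF zero_less_one bl])
    show "norm (F z - F y - L (z - y)) / norm (z - y) \<le> C * norm (z - y)" if "z \<noteq> y" for z
      using rem[of z] that by (simp add: divide_le_eq power2_eq_square mult_ac)
    have "((\<lambda>z. C * norm (z - y)) \<longlongrightarrow> C * norm (y - y)) (at y)" by (intro tendsto_intros)
    then show "((\<lambda>z. C * norm (z - y)) \<longlongrightarrow> 0) (at y)" by simp
  qed
  then show ?thesis unfolding F_def e_def by (rule differentiableI)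
qed

lemma squared_fourier_differentiable:
  assumes "piecewise_continuous f" and "\<And>x. r \<le> norm x \<Longrightarrow> f x = 0"
  shows "(\<lambda>x. (cmod (fourier3 f x))\<^sup>2) differentiable (at y)"
proof -
  have "fourier3 f differentiable (at y)"
    unfolding fourier3_def
    using fourier_integral_differentiable[OF piecewise_continuous_imp_integrable[OF assms] assms(2)]
    by (intro differentiable_mult) auto
  then obtain D where "(fourier3 f has_derivative D) (at y)" by (auto simp: differentiable_def)
  from has_derivative_inner[OF this this] show ?thesis
    unfolding differentiable_def power2_norm_eq_inner by blast
qed

section \<open>The stereographic coordinates\<close>

text \<open>
  The inverse stereographic projection from the plane at height \<open>- k\<^sub>0\<close> onto the sphere of
  radius \<open>k\<^sub>0\<close> about \<open>(0, 0, - k\<^sub>0)\<close>, projecting from the origin. This smooth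
  closed form replaces the choice of an inverse and the square root in \<^const>\<open>hemisphere\<close>.
\<close>

definition stereo :: "real \<Rightarrow> real^2 \<Rightarrow> real^3" where
  "stereo k0 y = (2 * k0\<^sup>2 / (k0\<^sup>2 + y \<bullet> y)) *\<^sub>R vector [y$1, y$2, - k0]"

lemma hemisphere_tau_inv:
  assumes k0: "k0 > 0" and y: "norm y > k0"
  shows "hemisphere k0 (tau_inv k0 y) = stereo k0 y"
proof -
  define n where "n = norm y"
  define c where "c = 2 * k0\<^sup>2 / (k0\<^sup>2 + n\<^sup>2)"
  have k: "tau_inv k0 y = c *\<^sub>R y" using tau_inv_eq[of k0 y] assms by (simp add: c_def n_def)
  have "tau k0 (c *\<^sub>R y) = y" using tau_inv_formula_mem(2)[OF assms] by (simp add: c_def n_def)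
  then have eq: "k0 / (k0 - kappa k0 (c *\<^sub>R y)) * c = 1"
    using y k0 unfolding tau_def by (metis norm_zero not_less_iff_gr_or_eq order_less_trans scaleR_cancel_right scaleR_one scaleR_scaleR)
  then have "k0 - kappa k0 (c *\<^sub>R y) \<noteq> 0" by auto
  then have "kappa k0 (c *\<^sub>R y) - k0 = c * (- k0)" using eq by (simp add: field_simps)
  then show ?thesis
    by (simp add: hemisphere_def stereo_def k c_def n_def power2_norm_eq_inner vec_eq_iff forall_3)
qed

lemma nu_tilde_eq:
  assumes "k0 > 0" and "norm y > k0"
  shows "nu_tilde k0 f R s y = (cmod (fourier3 f (R s *v stereo k0 y)))\<^sup>2"
  by (simp add: nu_tilde_def nu_def hemisphere_tau_inv[OF assms])

text \<open>
  In directions orthogonal to \<open>y\<close> the factor depending on \<open>y \<bullet> y\<close> is stationary. Only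
  these directions enter the infinitesimal relation, so the radial part stays unspecified.
\<close>

lemma stereo_has_derivative:
  assumes k0: "k0 > 0"
  obtains D where "(stereo k0 has_derivative D) (at y)"
    and "\<And>h. y \<bullet> h = 0 \<Longrightarrow> D h = (2 * k0\<^sup>2 / (k0\<^sup>2 + y \<bullet> y)) *\<^sub>R vector [h$1, h$2, 0]"
proof -
  define E :: "real^2 \<Rightarrow> real^3" where "E h = vector [h$1, h$2, 0]" for h
  define b :: "real^3" where "b = vector [0, 0, - k0]"
  have "linear E" by (rule linearI) (auto simp: E_def vec_eq_iff forall_3)
  then have E: "(E has_derivative E) (at y)"
    by (simp add: linear_imp_has_derivative)
  have pos: "k0\<^sup>2 + y \<bullet> y \<noteq> 0" using k0 by (smt (verit) inner_ge_zero zero_less_power)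
  have st: "stereo k0 = (\<lambda>y. (2 * k0\<^sup>2 / (k0\<^sup>2 + y \<bullet> y)) *\<^sub>R (E y + b))"
    by (auto simp: stereo_def E_def b_def vec_eq_iff forall_3)
  let ?D = "\<lambda>h. (2 * k0\<^sup>2 / (k0\<^sup>2 + y \<bullet> y)) *\<^sub>R E h
       + (- (2 * k0\<^sup>2 * (2 * (y \<bullet> h)) / (k0\<^sup>2 + y \<bullet> y)\<^sup>2)) *\<^sub>R (E y + b)"
  have "(stereo k0 has_derivative ?D) (at y)"
    unfolding st
    by (rule derivative_eq_intros E refl pos | simp add: fun_eq_iff inner_commute power2_eq_square field_simps)+
  then show ?thesis by (rule that) (simp add: E_def)
qed

section \<open>Derivatives of the scaled squared energy\<close>

lemma gradient_inner:
  fixes g :: "'a::euclidean_space \<Rightarrow> real"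
  assumes "(g has_derivative g') (at x)"
  shows "gradient g x \<bullet> h = g' h"
proof -
  have lin: "linear g'" using assms by (rule has_derivative_linear)
  have "h \<bullet> adjoint g' 1 = g' h" for h using adjoint_works[OF lin, of h 1] by simp
  then have "GDERIV g x :> adjoint g' 1" using assms by (simp add: gderiv_def)
  then show ?thesis using adjoint_works[OF lin, of h 1] by (simp add: gradient_eq inner_commute)
qed

lemma half_circle_norm: "\<phi> \<in> half_circle \<Longrightarrow> norm \<phi> = 1"
  by (auto simp: half_circle_def norm_eq_sqrt_inner inner_vec_def sum_2 power2_eq_square[symmetric])

text \<open>
  The heart of the matter: the cross product of \<open>(a \<phi>\<^sub>1, a \<phi>\<^sub>2, b)\<close> with
  \<open>(r \<phi>\<^sub>1, r \<phi>\<^sub>2, - k\<^sub>0)\<close> is \<open>k\<^sub>0 a + r b\<close> times the lift of \<^term>\<open>perp \<phi>\<close> to height \<open>0\<close>.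
  Hence moving in time and moving in the plane across the ray
  displace the evaluation point of the Fourier transform in proportional directions, and
  linearity of its derivative at that point transfers the proportionality factor.
\<close>

lemma relation_of_parallel_velocity:
  assumes k0: "k0 > 0" and T: "T > 0" and C1: "C1_rotations T R" and t: "t \<in> {0..T}"
    and diff: "\<And>y. (\<lambda>x. (cmod (fourier3 f x))\<^sup>2) differentiable (at y)"
    and \<phi>: "norm \<phi> = 1"
    and \<omega>: "angular_velocity T R t = vector [a * \<phi>$1, a * \<phi>$2, b]"
  shows "infinitesimal_relation k0 T f R t \<phi> a b"
  unfolding infinitesimal_relation_def
proof
  fix r assume "r \<in> - {-k0..k0}"
  then have nr: "norm (r *\<^sub>R \<phi>) > k0" using \<phi> by auto
  define g where "g x = (cmod (fourier3 f x))\<^sup>2" for x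
  define S where "S = stereo k0 (r *\<^sub>R \<phi>)"
  define c where "c = 2 * k0\<^sup>2 / (k0\<^sup>2 + r *\<^sub>R \<phi> \<bullet> r *\<^sub>R \<phi>)"
  have S: "S = c *\<^sub>R vector [r * \<phi>$1, r * \<phi>$2, - k0]" by (simp add: S_def c_def stereo_def)
  define R' where "R' = vector_derivative R (at t within {0..T})"
  define v :: "real^3" where "v = vector [perp \<phi> $ 1, perp \<phi> $ 2, 0]"
  obtain G where G: "(g has_derivative G) (at (R t *v S))"
    using diff unfolding g_def differentiable_def by blast
  have linG: "linear G" using G by (rule has_derivative_linear)
  have nb: "at t within {0..T} \<noteq> bot" using T t by (simp add: trivial_limit_within islimpt_Icc)
  have R': "(R has_vector_derivative R') (at t within {0..T})"
    using C1 t vector_derivative_within[OF nb] unfolding C1_rotations_def R'_def by metis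
  have "linear (\<lambda>A::real^3^3. A *v S)"
    by (rule linearI) (auto simp: matrix_vector_mult_add_rdistrib scaleR_matrix_vector_assoc)
  then have "bounded_linear (\<lambda>A::real^3^3. A *v S)" by (simp add: linear_conv_bounded_linear)
  from bounded_linear.has_vector_derivative[OF this R']
  have "((\<lambda>s. R s *v S) has_derivative (\<lambda>x. x *\<^sub>R (R' *v S))) (at t within {0..T})"
    by (simp add: has_vector_derivative_def)
  from has_derivative_compose[OF this G]
  have "((\<lambda>s. g (R s *v S)) has_vector_derivative G (R' *v S)) (at t within {0..T})"
    by (simp add: has_vector_derivative_def linear_cmul[OF linG])
  then have time: "vector_derivative (\<lambda>s. nu_tilde k0 f R s (r *\<^sub>R \<phi>)) (at t within {0..T}) = G (R' *v S)"
    unfolding nu_tilde_eq[OF k0 nr] S_def[symmetric] g_def[symmetric]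
    by (rule vector_derivative_within[OF nb])
  obtain D where D: "(stereo k0 has_derivative D) (at (r *\<^sub>R \<phi>))"
    and Dh: "\<And>h. r *\<^sub>R \<phi> \<bullet> h = 0 \<Longrightarrow> D h = c *\<^sub>R vector [h$1, h$2, 0]"
    using stereo_has_derivative[OF k0] unfolding c_def by metis
  have "((\<lambda>y. R t *v stereo k0 y) has_derivative (\<lambda>h. R t *v D h)) (at (r *\<^sub>R \<phi>))"
    using bounded_linear.has_derivative[OF matrix_vector_mul_bounded_linear D] .
  from has_derivative_compose[OF this G[unfolded S_def]]
  have "((\<lambda>y. g (R t *v stereo k0 y)) has_derivative (\<lambda>h. G (R t *v D h))) (at (r *\<^sub>R \<phi>))" .
  then have "(nu_tilde k0 f R t has_derivative (\<lambda>h. G (R t *v D h))) (at (r *\<^sub>R \<phi>))"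
  proof (rule has_derivative_transform_within_open)
    show "open (- cball 0 k0 :: (real^2) set)" by auto
    show "r *\<^sub>R \<phi> \<in> - cball 0 k0" using nr by auto
    show "g (R t *v stereo k0 y) = nu_tilde k0 f R t y" if "y \<in> - cball 0 k0" for y
      using that nu_tilde_eq[OF k0, of y] by (simp add: g_def not_le)
  qed
  then have "gradient (nu_tilde k0 f R t) (r *\<^sub>R \<phi>) \<bullet> perp \<phi> = G (R t *v D (perp \<phi>))"
    by (rule gradient_inner)
  also have "D (perp \<phi>) = c *\<^sub>R v"
    unfolding v_def by (rule Dh) (simp add: perp_def inner_vec_def sum_2)
  finally have space: "gradient (nu_tilde k0 f R t) (r *\<^sub>R \<phi>) \<bullet> perp \<phi> = G (R t *v (c *\<^sub>R v))" .
  have RRt: "R t ** transpose (R t) = mat 1"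
    using C1 t by (auto simp: C1_rotations_def rotation_matrix_def orthogonal_matrix_def)
  have "R' *v S = R t *v ((transpose (R t) ** R') *v S)"
    by (simp add: matrix_vector_mul_assoc matrix_mul_assoc RRt)
  also have "(transpose (R t) ** R') *v S = cross3 (angular_velocity T R t) S"
    unfolding R'_def by (rule angular_velocity[OF T C1 t])
  also have "\<dots> = (k0 * a + r * b) *\<^sub>R (c *\<^sub>R v)"
    by (simp add: \<omega> S v_def perp_def cross3_def vec_eq_iff forall_3 algebra_simps)
  finally have "R' *v S = (k0 * a + r * b) *\<^sub>R (R t *v (c *\<^sub>R v))"
    by (simp add: matrix_vector_mult_scaleR)
  then show "vector_derivative (\<lambda>s. nu_tilde k0 f R s (r *\<^sub>R \<phi>)) (at t within {0..T}) =
      (k0 * a + r * b) * (gradient (nu_tilde k0 f R t) (r *\<^sub>R \<phi>) \<bullet> perp \<phi>)"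
    by (simp add: time space linear_cmul[OF linG])
qed

section \<open>Recovering the angular velocity\<close>

text \<open>
  Polar coordinates with a signed radius: an angle of at least \<open>pi\<close> is shifted by
  \<open>pi\<close> at the cost of a sign.
\<close>

lemma half_circle_direction:
  obtains \<phi> a where "\<phi> \<in> half_circle" and "u = a *\<^sub>R \<phi>"
proof (cases "u = 0")
  case True
  have "vector [cos 0, sin 0] \<in> half_circle" unfolding half_circle_def using pi_gt_zero by blast
  then show ?thesis by (rule that[of _ 0]) (simp add: True)
next
  case False
  define n where "n = norm u"
  have n: "n \<noteq> 0" "n\<^sup>2 = (u$1)\<^sup>2 + (u$2)\<^sup>2"
    using False by (auto simp: n_def norm_vec_def L2_set_def sum_2 vec_eq_iff forall_2)
  have "(u$1 / n)\<^sup>2 + (u$2 / n)\<^sup>2 = ((u$1)\<^sup>2 + (u$2)\<^sup>2) / n\<^sup>2"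
    by (simp add: power_divide add_divide_distrib)
  then have "(u$1 / n)\<^sup>2 + (u$2 / n)\<^sup>2 = 1" unfolding n(2)[symmetric] using n(1) by simp
  then obtain \<theta> where \<theta>: "0 \<le> \<theta>" "\<theta> < 2 * pi" "u$1 / n = cos \<theta>" "u$2 / n = sin \<theta>"
    by (rule sincos_total_2pi)
  then have u: "u$1 = n * cos \<theta>" "u$2 = n * sin \<theta>" using n(1) by (auto simp: field_simps)
  show ?thesis
  proof (cases "\<theta> < pi")
    case True
    then have "vector [cos \<theta>, sin \<theta>] \<in> half_circle" unfolding half_circle_def using \<theta>(1) by blast
    then show ?thesis by (rule that[of _ n]) (simp add: vec_eq_iff forall_2 u)
  next
    case False
    then have "0 \<le> \<theta> - pi" "\<theta> - pi < pi" using \<theta>(2) by auto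
    then have "vector [cos (\<theta> - pi), sin (\<theta> - pi)] \<in> half_circle" unfolding half_circle_def by blast
    then show ?thesis by (rule that[of _ "- n"]) (simp add: vec_eq_iff forall_2 u)
  qed
qed

theorem theoremD5:
  fixes k0 T t \<rho> \<zeta> :: real
    and f :: "real^3 \<Rightarrow> real"
    and R :: "real \<Rightarrow> real^3^3"
    and \<phi> :: "real^2"
  assumes "k0 > 0" and "T > 0"
    and "\<And>x. f x \<ge> 0"
    and "piecewise_continuous f"
    and "\<exists>r>0. closure {x. f x \<noteq> 0} \<subseteq> ball 0 r"
    and "C1_rotations T R"
    and "R 0 = mat 1"
    and "t \<in> {0..T}"
    and "\<exists>!\<psi>. \<psi> \<in> half_circle \<and> (\<exists>\<rho>' \<zeta>'. infinitesimal_relation k0 T f R t \<psi> \<rho>' \<zeta>')"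
    and "\<phi> \<in> half_circle"
    and "infinitesimal_relation k0 T f R t \<phi> \<rho> \<zeta>"
    and "\<exists>r1 r2. r1 \<noteq> r2 \<and>
           {r1, r2} \<subseteq> {r \<in> - {-k0..k0}. gradient (nu_tilde k0 f R t) (r *\<^sub>R \<phi>) \<bullet> perp \<phi> \<noteq> 0}"
  shows "angular_velocity T R t = vector [\<rho> * \<phi>$1, \<rho> * \<phi>$2, \<zeta>]"
proof -
  define \<omega> where "\<omega> = angular_velocity T R t"
  obtain r where r: "closure {x. f x \<noteq> 0} \<subseteq> ball 0 r" using assms(5) by blast
  have supp: "f x = 0" if "r \<le> norm x" for x
    using that r closure_subset[of "{x. f x \<noteq> 0}"] by force
  have rel: "infinitesimal_relation k0 T f R t \<psi> a (\<omega>$3)"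
    if "\<psi> \<in> half_circle" and "\<omega>$1 = a * \<psi>$1" and "\<omega>$2 = a * \<psi>$2" for \<psi> a
    using that
    by (intro relation_of_parallel_velocity[OF assms(1,2,6,8)
          squared_fourier_differentiable[OF assms(4) supp]])
      (auto simp: half_circle_norm \<omega>_def[symmetric] vec_eq_iff forall_3)
  have unique: "\<psi> = \<phi>" if "\<psi> \<in> half_circle" and "\<omega>$1 = a * \<psi>$1" and "\<omega>$2 = a * \<psi>$2" for \<psi> a
    using rel[OF that] that(1) assms(9,10,11) by blast
  obtain \<psi> a where \<psi>: "\<psi> \<in> half_circle" and u: "(vector [\<omega>$1, \<omega>$2] :: real^2) = a *\<^sub>R \<psi>"
    by (rule half_circle_direction)
  have comp: "\<omega>$1 = a * \<psi>$1" "\<omega>$2 = a * \<psi>$2"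
    using u by (simp_all add: vec_eq_iff forall_2)
  have "\<psi> = \<phi>" by (rule unique[OF \<psi> comp])
  with comp have comp: "\<omega>$1 = a * \<phi>$1" "\<omega>$2 = a * \<phi>$2" by simp_all
  obtain r1 r2 where rr: "r1 \<noteq> r2" "r1 \<in> - {-k0..k0}" "r2 \<in> - {-k0..k0}"
    and nz: "gradient (nu_tilde k0 f R t) (r1 *\<^sub>R \<phi>) \<bullet> perp \<phi> \<noteq> 0"
      "gradient (nu_tilde k0 f R t) (r2 *\<^sub>R \<phi>) \<bullet> perp \<phi> \<noteq> 0"
    using assms(12) by blast
  have eq: "k0 * \<rho> + s * \<zeta> = k0 * a + s * \<omega>$3"
    if "s \<in> - {-k0..k0}" "gradient (nu_tilde k0 f R t) (s *\<^sub>R \<phi>) \<bullet> perp \<phi> \<noteq> 0" for s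
    using rel[OF assms(10) comp] assms(11) that unfolding infinitesimal_relation_def
    by (metis mult_right_cancel)
  have "(r1 - r2) * (\<zeta> - \<omega>$3) = 0"
    using eq[OF rr(2) nz(1)] eq[OF rr(3) nz(2)] by (simp add: algebra_simps)
  then have \<zeta>: "\<zeta> = \<omega>$3" using rr(1) by simp
  then have "\<rho> = a" using eq[OF rr(2) nz(1)] assms(1) by simp
  then show ?thesis
    using comp \<zeta> by (simp add: \<omega>_def[symmetric] vec_eq_iff forall_3)
qed

end
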